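(* Let $R$ be a commutative ring with identity whose set of zero-divisors contains a nonzero element, and let $n>1$. Then the orthogonality graph $O(M_n(R))$ is connected and has diameter at most $4$.
   Context: The orthogonality graph $O(S)$ of a ring $S$ is the undirected graph whose vertices are the nonzero two-sided zero-divisors of $S$, distinct vertices $x,y$ being adjacent iff $xy=yx=0$; the diameter is the supremum of graph distances between vertices. *)

theory Defs
  imports "HOL-Analysis.Analysis" "HOL-Library.Extended_Nat"
begin

text \<open>The orthogonality graph of a ring S whose elements form a type 'b, with
  multiplication mul and zero z passed explicitly (needed because on the type
  of matrices 'a^'n^'n the class multiplication is componentwise, while the
  ring multiplication is the matrix product).\<close>

definition two_sided_zd :: "('b \<Rightarrow> 'b \<Rightarrow> 'b) \<Rightarrow> 'b \<Rightarrow> 'b \<Rightarrow> bool" where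
  "two_sided_zd mul z x \<longleftrightarrow>
     (\<exists>a. a \<noteq> z \<and> mul a x = z) \<and> (\<exists>b. b \<noteq> z \<and> mul x b = z)"

definition orth_vertices :: "('b \<Rightarrow> 'b \<Rightarrow> 'b) \<Rightarrow> 'b \<Rightarrow> 'b set" where
  "orth_vertices mul z = {x. x \<noteq> z \<and> two_sided_zd mul z x}"

definition orth_adj :: "('b \<Rightarrow> 'b \<Rightarrow> 'b) \<Rightarrow> 'b \<Rightarrow> 'b \<Rightarrow> 'b \<Rightarrow> bool" where
  "orth_adj mul z x y \<longleftrightarrow> x \<in> orth_vertices mul z \<and> y \<in> orth_vertices mul z \<and>
     x \<noteq> y \<and> mul x y = z \<and> mul y x = z"

text \<open>A walk: nonempty list of vertices, consecutive entries adjacent.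
  It has length xs - 1 edges.\<close>
definition orth_walk :: "('b \<Rightarrow> 'b \<Rightarrow> 'b) \<Rightarrow> 'b \<Rightarrow> 'b list \<Rightarrow> bool" where
  "orth_walk mul z xs \<longleftrightarrow> xs \<noteq> [] \<and> set xs \<subseteq> orth_vertices mul z \<and>
     (\<forall>i. Suc i < length xs \<longrightarrow> orth_adj mul z (xs ! i) (xs ! Suc i))"

definition orth_connected :: "('b \<Rightarrow> 'b \<Rightarrow> 'b) \<Rightarrow> 'b \<Rightarrow> bool" where
  "orth_connected mul z \<longleftrightarrow>
     (\<forall>x\<in>orth_vertices mul z. \<forall>y\<in>orth_vertices mul z.
        \<exists>xs. orth_walk mul z xs \<and> hd xs = x \<and> last xs = y)"

text \<open>Graph distance (infinity if no walk exists) and diameter (supremum).\<close>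
definition orth_dist :: "('b \<Rightarrow> 'b \<Rightarrow> 'b) \<Rightarrow> 'b \<Rightarrow> 'b \<Rightarrow> 'b \<Rightarrow> enat" where
  "orth_dist mul z x y =
     (INF xs \<in> {xs. orth_walk mul z xs \<and> hd xs = x \<and> last xs = y}. enat (length xs - 1))"

definition orth_diam :: "('b \<Rightarrow> 'b \<Rightarrow> 'b) \<Rightarrow> 'b \<Rightarrow> enat" where
  "orth_diam mul z =
     (SUP x \<in> orth_vertices mul z. SUP y \<in> orth_vertices mul z. orth_dist mul z x y)"

end

theory Submission
  imports Defs
begin

text \<open>Every zero-divisor \<open>X\<close> of \<open>M\<^sub>n(R)\<close> has a nonzero two-sided annihilator, by McCoy's
  argument: if \<open>XB = 0\<close> and \<open>c\<close> is a nonzero entry of \<open>B\<close>, then \<open>c det X = 0\<close>. Let \<open>s + 1\<close> be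
  the least size such that \<open>c\<close> annihilates all minors of that size. Enlarging an \<open>s \<times> s\<close> minor
  not killed by \<open>c\<close> to an \<open>(s+1) \<times> (s+1)\<close> block, \<open>c\<close> times the adjugate of that block is
  nonzero, and by Laplace expansion its products with \<open>X\<close> on either side have entries that are
  \<open>c\<close>-multiples of \<open>(s+1)\<close>-minors, hence vanish.

  Now fix \<open>\<beta>, \<gamma> \<noteq> 0\<close> with \<open>\<beta>\<gamma> = 0\<close>. Replacing such an annihilator \<open>N\<close> of \<open>X\<close> by \<open>\<beta>N\<close>
  when that is nonzero, we get a neighbour with \<open>\<beta>N = 0\<close> or \<open>N \<in> \<beta>M\<^sub>n(R)\<close>. Two such
  neighbours of \<open>X\<close> and \<open>Y\<close> are orthogonal, or are both orthogonal to \<open>\<beta>I\<close> or to \<open>\<gamma>I\<close>, so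
  \<open>X\<close> and \<open>Y\<close> have distance at most 4.\<close>

section \<open>Cofactors\<close>

text \<open>Up to sign, the minor of \<open>W\<close> with row \<open>b\<close> and column \<open>a\<close> deleted, written without forming
  the submatrix.\<close>
definition cofactor :: "'a::comm_ring_1^'n^'n \<Rightarrow> 'n \<Rightarrow> 'n \<Rightarrow> 'a" where
  "cofactor W b a =
     det (\<chi> i j. if i = b then (if j = a then 1 else 0) else if j = a then 0 else W$i$j)"

lemma cofactor_cong:
  assumes "\<And>i j. i \<noteq> b \<Longrightarrow> j \<noteq> a \<Longrightarrow> W$i$j = W'$i$j"
  shows "cofactor W b a = cofactor W' b a"
  unfolding cofactor_def by (rule arg_cong[where f = det]) (simp add: vec_eq_iff assms)

lemma cofactor_transpose:
  fixes W :: "'a::comm_ring_1^'n::finite^'n"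
  shows "cofactor (transpose W) a b = cofactor W b a"
proof -
  let ?M = "(\<chi> i j. if i = b then (if j = a then 1 else 0) else if j = a then 0 else W$i$j)
    :: 'a^'n^'n"
  have "cofactor W b a = det (transpose ?M)"
    by (simp add: cofactor_def)
  also have "transpose ?M =
      (\<chi> i j. if i = a then (if j = b then 1 else 0) else if j = b then 0 else transpose W$i$j)"
    by (simp add: vec_eq_iff transpose_def)
  finally show ?thesis
    by (simp add: cofactor_def)
qed

lemma det_subtract_multiples_of_row:
  fixes W :: "'a::comm_ring_1^'n::finite^'n"
  assumes "finite S" "b \<notin> S"
  shows "det (\<chi> i. if i \<in> S then W$i - c i *s W$b else W$i) = det W"
  using assms
proof (induction S rule: finite_induct)
  case (insert s S)
  let ?W = "(\<chi> i. if i \<in> S then W$i - c i *s W$b else W$i) :: 'a^'n^'n"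
  have "(\<chi> i. if i \<in> insert s S then W$i - c i *s W$b else W$i) =
      (\<chi> k. if k = s then row s ?W + (- c s) *s row b ?W else row k ?W)"
    using insert by (auto simp: vec_eq_iff row_def)
  then show ?case
    using insert det_row_operation[of s b ?W "- c s"] by auto
qed simp

lemma det_eq_cofactor_if_unit_row:
  fixes W :: "'a::comm_ring_1^'n::finite^'n"
  assumes "W$b = axis a 1"
  shows "det W = cofactor W b a"
proof -
  have "(\<chi> i j. if i = b then (if j = a then 1 else 0) else if j = a then 0 else W$i$j) =
      (\<chi> i. if i \<in> UNIV - {b} then W$i - W$i$a *s W$b else W$i)"
    using assms by (auto simp: vec_eq_iff axis_def)
  then show ?thesis
    unfolding cofactor_def
    using det_subtract_multiples_of_row[of "UNIV - {b}" b W "\<lambda>i. W$i$a"] by simp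
qed

lemma det_cofactor_expansion:
  fixes W :: "'a::comm_ring_1^'n::finite^'n"
  shows "det W = (\<Sum>a\<in>UNIV. W$b$a * cofactor W b a)"
proof -
  let ?R = "\<lambda>v. (\<chi> i. if i = b then v else W$i) :: 'a^'n^'n"
  have "?R (W$b) = W"
    by (simp add: vec_eq_iff)
  then have "det W = det (?R (\<Sum>a\<in>UNIV. W$b$a *s axis a 1))"
    by (simp only: basis_expansion)
  also have "\<dots> = (\<Sum>a\<in>UNIV. W$b$a * det (?R (axis a 1)))"
    by (simp add: det_linear_row_sum det_row_mul)
  also have "\<dots> = (\<Sum>a\<in>UNIV. W$b$a * cofactor W b a)"
  proof -
    have "det (?R (axis a 1)) = cofactor W b a" for a
      by (subst det_eq_cofactor_if_unit_row[of _ b a]) (auto intro: cofactor_cong)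
    then show ?thesis by simp
  qed
  finally show ?thesis .
qed

section \<open>Two-sided annihilators of zero-divisors in matrix rings\<close>

text \<open>The block on \<open>I \<times> J\<close> carries the entries \<open>X$(\<rho> i)$(\<sigma> j)\<close>, the rest of the matrix is \<open>N\<close>
  with zeros on \<open>I \<times> -J\<close> and \<open>-I \<times> J\<close>. So its determinant is a \<open>card I\<close>-minor of \<open>X\<close> (zero unless
  \<open>\<rho>\<close>, \<open>\<sigma>\<close> are injective) times a minor of \<open>N\<close>; quantifying over all \<open>\<rho>\<close>, \<open>\<sigma>\<close>, \<open>N\<close> in
  \<open>annihilates_minors\<close> thus expresses ``\<open>c\<close> annihilates all \<open>t\<close>-minors of \<open>X\<close>''.\<close>
definition embed_minor ::
    "'a::comm_ring_1^'n^'n \<Rightarrow> 'n set \<Rightarrow> 'n set \<Rightarrow> ('n \<Rightarrow> 'n) \<Rightarrow> ('n \<Rightarrow> 'n) \<Rightarrow> 'a^'n^'n \<Rightarrow> 'a^'n^'n" where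
  "embed_minor X I J \<rho> \<sigma> N = (\<chi> i j. if i \<in> I then (if j \<in> J then X$(\<rho> i)$(\<sigma> j) else 0)
       else (if j \<in> J then 0 else N$i$j))"

definition annihilates_minors :: "'a::comm_ring_1 \<Rightarrow> 'a^'n^'n \<Rightarrow> nat \<Rightarrow> bool" where
  "annihilates_minors c X t \<longleftrightarrow>
     (\<forall>I J \<rho> \<sigma> N. card I = t \<longrightarrow> card J = t \<longrightarrow> c * det (embed_minor X I J \<rho> \<sigma> N) = 0)"

text \<open>\<open>c\<close> times the adjugate of the \<open>I \<times> J\<close> block of \<open>embed_minor X I J \<rho> \<sigma> N\<close>, placed on rows
  \<open>\<sigma> ` J\<close> and columns \<open>\<rho> ` I\<close>.\<close>
definition minor_adjugate ::
    "'a::comm_ring_1 \<Rightarrow> 'a^'n^'n \<Rightarrow> 'n set \<Rightarrow> 'n set \<Rightarrow> ('n \<Rightarrow> 'n) \<Rightarrow> ('n \<Rightarrow> 'n) \<Rightarrow> 'a^'n^'n \<Rightarrow> 'a^'n^'n" where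
  "minor_adjugate c X I J \<rho> \<sigma> N = (\<chi> x y. c * (\<Sum>b\<in>{b\<in>I. \<rho> b = y}. \<Sum>a\<in>{a\<in>J. \<sigma> a = x}.
       cofactor (embed_minor X I J \<rho> \<sigma> N) b a))"

lemma det_embed_minor_expansion:
  fixes X :: "'a::comm_ring_1^'n::finite^'n"
  assumes "b \<in> I"
  shows "det (embed_minor X I J (\<rho>(b := r)) \<sigma> N) =
    (\<Sum>a\<in>J. X$r$(\<sigma> a) * cofactor (embed_minor X I J \<rho> \<sigma> N) b a)"
proof -
  have "cofactor (embed_minor X I J (\<rho>(b := r)) \<sigma> N) b a = cofactor (embed_minor X I J \<rho> \<sigma> N) b a" for a
    by (rule cofactor_cong) (simp add: embed_minor_def)
  then show ?thesis
    using assms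
    by (simp add: det_cofactor_expansion[of _ b] embed_minor_def if_distrib[of "\<lambda>x. x * _"]
        sum.If_cases Int_absorb1 cong: if_cong)
qed

lemma matrix_mult_minor_adjugate:
  fixes X :: "'a::comm_ring_1^'n::finite^'n"
  shows "(X ** minor_adjugate c X I J \<rho> \<sigma> N)$r$y =
    c * (\<Sum>b\<in>{b\<in>I. \<rho> b = y}. det (embed_minor X I J (\<rho>(b := r)) \<sigma> N))"
proof -
  let ?C = "cofactor (embed_minor X I J \<rho> \<sigma> N)"
  have group: "(\<Sum>x\<in>UNIV. \<Sum>a\<in>{a\<in>J. \<sigma> a = x}. X$r$x * ?C b a) = (\<Sum>a\<in>J. X$r$(\<sigma> a) * ?C b a)"
    for b
  proof -
    have "(\<Sum>x\<in>UNIV. \<Sum>a\<in>{a\<in>J. \<sigma> a = x}. X$r$x * ?C b a) =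
        (\<Sum>x\<in>UNIV. \<Sum>a\<in>{a\<in>J. \<sigma> a = x}. X$r$(\<sigma> a) * ?C b a)"
      by (intro sum.cong) auto
    also have "\<dots> = (\<Sum>a\<in>J. X$r$(\<sigma> a) * ?C b a)"
      by (rule sum.group) auto
    finally show ?thesis .
  qed
  have "(X ** minor_adjugate c X I J \<rho> \<sigma> N)$r$y =
      c * (\<Sum>b\<in>{b\<in>I. \<rho> b = y}. \<Sum>x\<in>UNIV. \<Sum>a\<in>{a\<in>J. \<sigma> a = x}. X$r$x * ?C b a)"
    by (simp add: matrix_matrix_mult_def minor_adjugate_def sum_distrib_left mult_ac sum.swap[of _ UNIV])
  also have "\<dots> = c * (\<Sum>b\<in>{b\<in>I. \<rho> b = y}. \<Sum>a\<in>J. X$r$(\<sigma> a) * ?C b a)"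
    by (simp only: group)
  finally show ?thesis
    by (simp add: det_embed_minor_expansion)
qed

lemma annihilates_minors_mult_minor_adjugate:
  fixes X :: "'a::comm_ring_1^'n::finite^'n"
  assumes "annihilates_minors c X t" "card I = t" "card J = t"
  shows "X ** minor_adjugate c X I J \<rho> \<sigma> N = 0"
proof -
  have "c * det (embed_minor X I J (\<rho>(b := r)) \<sigma> N) = 0" for b r
    using assms by (simp add: annihilates_minors_def)
  then show ?thesis
    by (simp add: vec_eq_iff matrix_mult_minor_adjugate sum_distrib_left)
qed

lemma transpose_embed_minor:
  "transpose (embed_minor X I J \<rho> \<sigma> N) = embed_minor (transpose X) J I \<sigma> \<rho> (transpose N)"
  by (simp add: vec_eq_iff embed_minor_def transpose_def)

lemma annihilates_minors_transpose:
  fixes X :: "'a::comm_ring_1^'n::finite^'n"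
  assumes "annihilates_minors c X t"
  shows "annihilates_minors c (transpose X) t"
  unfolding annihilates_minors_def
proof (intro allI impI)
  fix I J :: "'n set" and \<rho> \<sigma> :: "'n \<Rightarrow> 'n" and N :: "'a^'n^'n"
  assume "card I = t" "card J = t"
  then have "c * det (embed_minor X J I \<sigma> \<rho> (transpose N)) = 0"
    using assms by (simp add: annihilates_minors_def)
  then show "c * det (embed_minor (transpose X) I J \<rho> \<sigma> N) = 0"
    using det_transpose[of "embed_minor X J I \<sigma> \<rho> (transpose N)"]
    by (simp add: transpose_embed_minor)
qed

lemma transpose_minor_adjugate:
  fixes X :: "'a::comm_ring_1^'n::finite^'n"
  shows "transpose (minor_adjugate c X I J \<rho> \<sigma> N) = minor_adjugate c (transpose X) J I \<sigma> \<rho> (transpose N)"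
proof -
  have "cofactor (embed_minor X I J \<rho> \<sigma> N) b a =
      cofactor (embed_minor (transpose X) J I \<sigma> \<rho> (transpose N)) a b" for a b
    by (metis cofactor_transpose transpose_embed_minor)
  then show ?thesis
    unfolding minor_adjugate_def transpose_def
    by (simp add: vec_eq_iff sum.swap[of _ "{b\<in>I. _ b}"])
qed

lemma minor_adjugate_mult_annihilates_minors:
  fixes X :: "'a::comm_ring_1^'n::finite^'n"
  assumes "annihilates_minors c X t" "card I = t" "card J = t"
  shows "minor_adjugate c X I J \<rho> \<sigma> N ** X = 0"
proof -
  have "transpose X ** minor_adjugate c (transpose X) J I \<sigma> \<rho> (transpose N) = 0"
    using annihilates_minors_mult_minor_adjugate annihilates_minors_transpose assms by blast
  then have "transpose (minor_adjugate c X I J \<rho> \<sigma> N ** X) = 0"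
    by (simp add: matrix_transpose_mul transpose_minor_adjugate)
  then show ?thesis
    by (metis transpose_transpose transpose_mat mat_0)
qed

lemma not_annihilates_minors_0:
  fixes X :: "'a::comm_ring_1^'n::finite^'n"
  assumes "c \<noteq> 0"
  shows "\<not> annihilates_minors c X 0"
proof
  assume "annihilates_minors c X 0"
  then have "c * det (embed_minor X {} {} id id (mat 1)) = 0"
    by (simp add: annihilates_minors_def)
  moreover have "embed_minor X {} {} id id (mat 1) = mat 1"
    by (simp add: embed_minor_def vec_eq_iff)
  ultimately show False
    using assms by simp
qed

lemma matrix_mult_selection:
  fixes A :: "'a::comm_ring_1^'n::finite^'n"
  shows "((\<chi> i j. if j = f i then 1 else 0) ** A)$i$j = A$(f i)$j"
    and "(A ** (\<chi> i j. if i = g j then 1 else 0))$i$j = A$i$(g j)"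
  by (simp_all add: matrix_matrix_mult_def if_distrib[of "\<lambda>x. x * _"] if_distrib[of "\<lambda>x. _ * x"]
      sum.delta cong: if_cong)

lemma annihilates_minors_CARD:
  fixes X :: "'a::comm_ring_1^'n::finite^'n"
  assumes "c * det X = 0"
  shows "annihilates_minors c X CARD('n)"
  unfolding annihilates_minors_def
proof (intro allI impI)
  fix I J :: "'n set" and \<rho> \<sigma> :: "'n \<Rightarrow> 'n" and N :: "'a^'n^'n"
  assume "card I = CARD('n)" "card J = CARD('n)"
  then have "I = UNIV" "J = UNIV"
    by (simp_all add: card_eq_UNIV_imp_eq_UNIV)
  then have "embed_minor X I J \<rho> \<sigma> N =
      (\<chi> i j. if j = \<rho> i then 1 else 0) ** X ** (\<chi> i j. if i = \<sigma> j then 1 else 0)"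
    by (simp add: embed_minor_def vec_eq_iff matrix_mult_selection)
  then have "c * det (embed_minor X I J \<rho> \<sigma> N) =
      (c * det X) * (det (\<chi> i j. if j = \<rho> i then 1 else 0) * det (\<chi> i j. if i = \<sigma> j then 1 else 0))"
    by (simp add: det_mul mult_ac)
  then show "c * det (embed_minor X I J \<rho> \<sigma> N) = 0"
    using assms by simp
qed

lemma det_mult_kernel_component:
  fixes X :: "'a::comm_ring_1^'n::finite^'n"
  assumes "X *v v = 0"
  shows "v$k * det X = 0"
proof -
  let ?R = "\<lambda>w. (\<chi> i. if i = k then w else transpose X$i) :: 'a^'n^'n"
  have sum_rows: "(\<Sum>i\<in>UNIV. v$i *s transpose X$i) = 0"
    using assms
    by (simp add: vec_eq_iff matrix_vector_mult_def transpose_def sum_component mult.commute)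
  have "0 = det (?R 0)"
    by (simp add: det_row_0)
  also have "\<dots> = det (?R (\<Sum>i\<in>UNIV. v$i *s transpose X$i))"
    by (simp only: sum_rows)
  also have "\<dots> = (\<Sum>i\<in>UNIV. v$i * det (?R (transpose X$i)))"
    by (simp add: det_linear_row_sum det_row_mul)
  also have "\<dots> = (\<Sum>i\<in>UNIV. if i = k then v$k * det X else 0)"
  proof (rule sum.cong)
    fix i
    show "v$i * det (?R (transpose X$i)) = (if i = k then v$k * det X else 0)"
    proof (cases "i = k")
      case True
      then have "?R (transpose X$i) = transpose X"
        by (simp add: vec_eq_iff)
      then show ?thesis
        using True by simp
    next
      case False
      then have "det (?R (transpose X$i)) = 0"
        by (intro det_identical_rows[of i k]) (simp_all add: row_def vec_eq_iff)
      then show ?thesis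
        using False by simp
    qed
  qed simp
  finally show ?thesis
    by simp
qed

lemma nonzero_cofactor_outside_block:
  fixes X :: "'a::comm_ring_1^'n::finite^'n"
  assumes "c * det (embed_minor X I J \<rho> \<sigma> N) \<noteq> 0" "b \<notin> I"
  shows "\<exists>a. a \<notin> J \<and> c * cofactor (embed_minor X I J \<rho> \<sigma> N) b a \<noteq> 0"
proof (rule ccontr)
  assume "\<nexists>a. a \<notin> J \<and> c * cofactor (embed_minor X I J \<rho> \<sigma> N) b a \<noteq> 0"
  moreover have "embed_minor X I J \<rho> \<sigma> N$b$a = (if a \<in> J then 0 else N$b$a)" for a
    using assms(2) by (simp add: embed_minor_def)
  ultimately have "c * (embed_minor X I J \<rho> \<sigma> N$b$a * cofactor (embed_minor X I J \<rho> \<sigma> N) b a) = 0"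
    for a
    by (cases "a \<in> J") (auto simp: mult.left_commute[of c])
  then have "c * det (embed_minor X I J \<rho> \<sigma> N) = 0"
    by (simp add: det_cofactor_expansion[of _ b] sum_distrib_left)
  with assms(1) show False
    by simp
qed

lemma minor_adjugate_entry:
  assumes "b \<in> I" "\<And>b'. b' \<in> I \<Longrightarrow> \<rho> b' = \<rho> b \<Longrightarrow> b' = b"
    and "a \<in> J" "\<And>a'. a' \<in> J \<Longrightarrow> \<sigma> a' = \<sigma> a \<Longrightarrow> a' = a"
  shows "minor_adjugate c X I J \<rho> \<sigma> N $ \<sigma> a $ \<rho> b = c * cofactor (embed_minor X I J \<rho> \<sigma> N) b a"
proof -
  have "{b'\<in>I. \<rho> b' = \<rho> b} = {b}" "{a'\<in>J. \<sigma> a' = \<sigma> a} = {a}"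
    using assms by auto
  then show ?thesis
    by (simp add: minor_adjugate_def)
qed

lemma two_sided_annihilator_of_minor_rank:
  fixes X :: "'a::comm_ring_1^'n::finite^'n"
  assumes "annihilates_minors c X (Suc s)" "\<not> annihilates_minors c X s" "s < CARD('n)"
  shows "\<exists>M. M \<noteq> 0 \<and> X ** M = 0 \<and> M ** X = 0"
proof -
  obtain I J :: "'n set" and \<rho> \<sigma> :: "'n \<Rightarrow> 'n" and N :: "'a^'n^'n"
    where card: "card I = s" "card J = s" and nz: "c * det (embed_minor X I J \<rho> \<sigma> N) \<noteq> 0"
    using assms(2) unfolding annihilates_minors_def by blast
  have "card I < CARD('n)" "card (\<rho> ` I) < CARD('n)" "card (\<sigma> ` J) < CARD('n)"
    using card assms(3) card_image_le[of I \<rho>] card_image_le[of J \<sigma>] by auto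
  then have "I \<noteq> UNIV" "\<rho> ` I \<noteq> UNIV" "\<sigma> ` J \<noteq> UNIV"
    by auto
  then obtain b y x where "b \<notin> I" "y \<notin> \<rho> ` I" "x \<notin> \<sigma> ` J"
    by blast
  obtain a where "a \<notin> J" and nz_cof: "c * cofactor (embed_minor X I J \<rho> \<sigma> N) b a \<noteq> 0"
    using nonzero_cofactor_outside_block[OF nz \<open>b \<notin> I\<close>] by blast
  let ?I = "insert b I" and ?J = "insert a J" and ?\<rho> = "\<rho>(b := y)" and ?\<sigma> = "\<sigma>(a := x)"
  let ?M = "minor_adjugate c X ?I ?J ?\<rho> ?\<sigma> N"
  txt \<open>As \<open>y \<notin> \<rho> ` I\<close> and \<open>x \<notin> \<sigma> ` J\<close>, entry \<open>(x, y)\<close> of \<open>?M\<close> only receives the \<open>(b, a)\<close>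
    cofactor of the enlarged block, which is \<open>c\<close> times the old minor.\<close>
  have "cofactor (embed_minor X ?I ?J ?\<rho> ?\<sigma> N) b a = cofactor (embed_minor X I J \<rho> \<sigma> N) b a"
    by (rule cofactor_cong) (simp add: embed_minor_def)
  then have "?M $ x $ y = c * cofactor (embed_minor X I J \<rho> \<sigma> N) b a"
    using minor_adjugate_entry[of b ?I ?\<rho> a ?J ?\<sigma> c X N]
      \<open>y \<notin> \<rho> ` I\<close> \<open>x \<notin> \<sigma> ` J\<close> by force
  then have "?M \<noteq> 0"
    using nz_cof by auto
  have "card ?I = Suc s" "card ?J = Suc s"
    using card \<open>b \<notin> I\<close> \<open>a \<notin> J\<close> by simp_all
  then have "X ** ?M = 0" "?M ** X = 0"
    using annihilates_minors_mult_minor_adjugate minor_adjugate_mult_annihilates_minors assms(1)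
    by blast+
  with \<open>?M \<noteq> 0\<close> show ?thesis
    by blast
qed

theorem matrix_two_sided_annihilator:
  fixes X B :: "'a::comm_ring_1^'n::finite^'n"
  assumes "X ** B = 0" "B \<noteq> 0"
  shows "\<exists>M. M \<noteq> 0 \<and> X ** M = 0 \<and> M ** X = 0"
proof -
  obtain k l where c: "B$k$l \<noteq> 0"
    using assms(2) by (metis vec_eq_iff zero_index)
  have "X *v column l B = 0"
    using assms(1) by (simp add: vec_eq_iff matrix_vector_mult_def matrix_matrix_mult_def column_def)
  then have "B$k$l * det X = 0"
    using det_mult_kernel_component[of X "column l B" k] by (simp add: column_def)
  then obtain s where "s < CARD('n)" "\<not> annihilates_minors (B$k$l) X s"
      "annihilates_minors (B$k$l) X (Suc s)"
    using ex_least_nat_less[of "annihilates_minors (B$k$l) X"]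
      annihilates_minors_CARD not_annihilates_minors_0[OF c] by blast
  then show ?thesis
    using two_sided_annihilator_of_minor_rank by blast
qed

section \<open>Walks in the orthogonality graph\<close>

lemma orth_vertexI:
  assumes "x \<noteq> z" "y \<noteq> z" "mul x y = z" "mul y x = z"
  shows "x \<in> orth_vertices mul z"
  using assms by (auto simp: orth_vertices_def two_sided_zd_def)

lemma orth_walk_Cons:
  assumes "orth_adj mul z x y" "orth_walk mul z (y # ys)"
  shows "orth_walk mul z (x # y # ys)"
  unfolding orth_walk_def
proof (intro conjI allI impI)
  show "set (x # y # ys) \<subseteq> orth_vertices mul z"
    using assms by (auto simp: orth_walk_def orth_adj_def)
  fix i
  assume "Suc i < length (x # y # ys)"
  then show "orth_adj mul z ((x # y # ys) ! i) ((x # y # ys) ! Suc i)"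
    using assms by (cases i) (auto simp: orth_walk_def)
qed simp

definition orth_within :: "('b \<Rightarrow> 'b \<Rightarrow> 'b) \<Rightarrow> 'b \<Rightarrow> nat \<Rightarrow> 'b \<Rightarrow> 'b \<Rightarrow> bool" where
  "orth_within mul z k x y \<longleftrightarrow>
     (\<exists>xs. orth_walk mul z xs \<and> hd xs = x \<and> last xs = y \<and> length xs \<le> Suc k)"

lemma orth_within_refl:
  assumes "x \<in> orth_vertices mul z"
  shows "orth_within mul z k x x"
  unfolding orth_within_def
  by (rule exI[of _ "[x]"]) (simp add: orth_walk_def assms)

lemma orth_within_Cons:
  assumes "x \<in> orth_vertices mul z" "x = y \<or> mul x y = z \<and> mul y x = z"
    and "orth_within mul z k y w"
  shows "orth_within mul z (Suc k) x w"
proof -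
  obtain ys where ys: "orth_walk mul z ys" "hd ys = y" "last ys = w" "length ys \<le> Suc k"
    using assms(3) by (auto simp: orth_within_def)
  then obtain ys' where ys': "ys = y # ys'"
    by (cases ys) (auto simp: orth_walk_def)
  show ?thesis
  proof (cases "x = y")
    case True
    then show ?thesis
      using ys by (auto simp: orth_within_def)
  next
    case False
    then have "orth_adj mul z x y"
      using assms(1,2) ys ys' by (auto simp: orth_adj_def orth_walk_def)
    then have "orth_walk mul z (x # ys)"
      using ys(1) ys' orth_walk_Cons by metis
    then show ?thesis
      using ys ys' unfolding orth_within_def by (intro exI[of _ "x # ys"]) auto
  qed
qed

lemma orth_connected_diam_le:
  assumes "\<And>x y. x \<in> orth_vertices mul z \<Longrightarrow> y \<in> orth_vertices mul z \<Longrightarrow> orth_within mul z k x y"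
  shows "orth_connected mul z \<and> orth_diam mul z \<le> enat k"
proof
  show "orth_connected mul z"
    using assms unfolding orth_connected_def orth_within_def by blast
  show "orth_diam mul z \<le> enat k"
    unfolding orth_diam_def
  proof (intro SUP_least)
    fix x y
    assume "x \<in> orth_vertices mul z" "y \<in> orth_vertices mul z"
    then obtain xs where "orth_walk mul z xs" "hd xs = x" "last xs = y" "length xs \<le> Suc k"
      using assms unfolding orth_within_def by blast
    then show "orth_dist mul z x y \<le> enat k"
      unfolding orth_dist_def by (intro INF_lower2[of xs]) auto
  qed
qed

section \<open>Scalar matrices and short walks in the orthogonality graph of matrices\<close>

lemma mat_mult_commute:
  fixes A :: "'a::comm_semiring_1^'n::finite^'n"
  shows "mat r ** A = A ** mat r"
  by (simp add: vec_eq_iff matrix_matrix_mult_def mat_def if_distrib[of "\<lambda>x. x * _"]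
      if_distrib[of "\<lambda>x. _ * x"] mult.commute sum.delta cong: if_cong)

lemma mat_mult_mat: "mat r ** mat s = (mat (r * s) :: 'a::semiring_1^'n::finite^'n)"
  by (simp add: vec_eq_iff matrix_matrix_mult_def mat_def if_distrib[of "\<lambda>x. x * _"] sum.delta
      cong: if_cong)

lemma mat_eq_0_iff: "(mat r :: 'a::zero^'n^'n) = 0 \<longleftrightarrow> r = 0"
  by (simp add: vec_eq_iff mat_def)

lemma mat_annihilated_mult:
  fixes P K :: "'a::comm_semiring_1^'n::finite^'n"
  assumes "mat s ** P = 0"
  shows "P ** (mat s ** K) = 0" "(mat s ** K) ** P = 0"
proof -
  have "P ** (mat s ** K) = (mat s ** P) ** K"
    by (simp only: matrix_mul_assoc mat_mult_commute[of s P])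
  moreover have "(mat s ** K) ** P = K ** (mat s ** P)"
    by (simp only: matrix_mul_assoc mat_mult_commute[of s K])
  ultimately show "P ** (mat s ** K) = 0" "(mat s ** K) ** P = 0"
    using assms by simp_all
qed

lemma mat_annihilated_mult_mat:
  fixes P :: "'a::comm_semiring_1^'n::finite^'n"
  assumes "mat s ** P = 0"
  shows "P ** mat s = 0"
  using assms by (simp add: mat_mult_commute)

lemma mat_in_orth_vertices:
  fixes P :: "'a::comm_ring_1^'n::finite^'n"
  assumes "s \<noteq> 0" "P \<noteq> 0" "mat s ** P = 0"
  shows "(mat s :: 'a^'n^'n) \<in> orth_vertices (**) 0"
  using assms mat_annihilated_mult_mat[OF assms(3)]
  by (intro orth_vertexI[of _ 0 P]) (simp_all add: mat_eq_0_iff)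

lemma matrix_scalar_annihilated_neighbour:
  fixes X :: "'a::comm_ring_1^'n::finite^'n"
  assumes "X \<in> orth_vertices (**) 0"
  obtains N where "N \<in> orth_vertices (**) 0" "X ** N = 0" "N ** X = 0"
    "mat \<beta> ** N = 0 \<or> (\<exists>K. N = mat \<beta> ** K)"
proof -
  obtain B :: "'a^'n^'n" where "B \<noteq> 0" "X ** B = 0"
    using assms by (auto simp: orth_vertices_def two_sided_zd_def)
  then obtain M where M: "M \<noteq> 0" "X ** M = 0" "M ** X = 0"
    using matrix_two_sided_annihilator by blast
  have "X \<noteq> 0"
    using assms by (simp add: orth_vertices_def)
  then have vertex: "N \<in> orth_vertices (**) 0" if "N \<noteq> 0" "X ** N = 0" "N ** X = 0" for N
    using that by (intro orth_vertexI[of _ _ X]) simp_all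
  show thesis
  proof (cases "mat \<beta> ** M = 0")
    case True
    then show thesis
      using M vertex that by blast
  next
    case False
    have "X ** (mat \<beta> ** M) = mat \<beta> ** (X ** M)" "(mat \<beta> ** M) ** X = mat \<beta> ** (M ** X)"
      by (simp_all only: matrix_mul_assoc mat_mult_commute[of \<beta> X])
    then show thesis
      using False M vertex that[of "mat \<beta> ** M"] by auto
  qed
qed

lemma matrix_orth_hub:
  fixes N N' :: "'a::comm_ring_1^'n::finite^'n" and \<beta> \<gamma> :: 'a
  assumes "\<beta> \<noteq> 0" "\<gamma> \<noteq> 0" "\<beta> * \<gamma> = 0"
    and "N \<in> orth_vertices (**) 0" "mat \<beta> ** N = 0 \<or> (\<exists>K. N = mat \<beta> ** K)"
    and "N' \<in> orth_vertices (**) 0" "mat \<beta> ** N' = 0 \<or> (\<exists>K. N' = mat \<beta> ** K)"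
  shows "\<exists>H\<in>orth_vertices (**) 0. (N = H \<or> N ** H = 0 \<and> H ** N = 0) \<and>
    (H = N' \<or> H ** N' = 0 \<and> N' ** H = 0)"
proof -
  have "N \<noteq> 0"
    using assms(4) by (simp add: orth_vertices_def)
  show ?thesis
  proof (cases "mat \<beta> ** N = 0"; cases "mat \<beta> ** N' = 0")
    assume "mat \<beta> ** N = 0" "mat \<beta> ** N' = 0"
    then show ?thesis
      using mat_in_orth_vertices[OF assms(1) \<open>N \<noteq> 0\<close>] mat_annihilated_mult_mat by blast
  next
    assume "mat \<beta> ** N = 0" "mat \<beta> ** N' \<noteq> 0"
    then show ?thesis
      using assms(6,7) mat_annihilated_mult by blast
  next
    assume "mat \<beta> ** N \<noteq> 0" "mat \<beta> ** N' = 0"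
    then show ?thesis
      using assms(4,5) mat_annihilated_mult by blast
  next
    assume "mat \<beta> ** N \<noteq> 0" "mat \<beta> ** N' \<noteq> 0"
    then obtain K K' where "N = mat \<beta> ** K" "N' = mat \<beta> ** K'"
      using assms(5,7) by blast
    then have "mat \<gamma> ** N = 0" "mat \<gamma> ** N' = 0"
      using assms(3) by (simp_all add: matrix_mul_assoc mat_mult_mat mult.commute)
    then show ?thesis
      using mat_in_orth_vertices[OF assms(2) \<open>N \<noteq> 0\<close>] mat_annihilated_mult_mat by blast
  qed
qed

lemma matrix_orth_within_4:
  fixes X Y :: "'a::comm_ring_1^'n::finite^'n" and \<beta> \<gamma> :: 'a
  assumes "\<beta> \<noteq> 0" "\<gamma> \<noteq> 0" "\<beta> * \<gamma> = 0"
    and X: "X \<in> orth_vertices (**) 0" and Y: "Y \<in> orth_vertices (**) 0"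
  shows "orth_within (**) 0 4 X Y"
proof -
  obtain N where N: "N \<in> orth_vertices (**) 0" "X ** N = 0" "N ** X = 0"
    "mat \<beta> ** N = 0 \<or> (\<exists>K. N = mat \<beta> ** K)"
    using matrix_scalar_annihilated_neighbour[OF X] by metis
  obtain N' where N': "N' \<in> orth_vertices (**) 0" "Y ** N' = 0" "N' ** Y = 0"
    "mat \<beta> ** N' = 0 \<or> (\<exists>K. N' = mat \<beta> ** K)"
    using matrix_scalar_annihilated_neighbour[OF Y] by metis
  obtain H where H: "H \<in> orth_vertices (**) 0" "N = H \<or> N ** H = 0 \<and> H ** N = 0"
    "H = N' \<or> H ** N' = 0 \<and> N' ** H = 0"
    using matrix_orth_hub[OF assms(1-3) N(1,4) N'(1,4)] by blast
  have "orth_within (**) 0 0 Y Y"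
    using Y by (rule orth_within_refl)
  then have "orth_within (**) 0 (Suc 0) N' Y"
    using N'(2,3) by (intro orth_within_Cons[OF N'(1)]) auto
  then have "orth_within (**) 0 (Suc (Suc 0)) H Y"
    by (rule orth_within_Cons[OF H(1,3)])
  then have "orth_within (**) 0 (Suc (Suc (Suc 0))) N Y"
    by (rule orth_within_Cons[OF N(1) H(2)])
  then have "orth_within (**) 0 (Suc (Suc (Suc (Suc 0)))) X Y"
    using N(2,3) by (intro orth_within_Cons[OF X]) auto
  then show ?thesis
    by (simp add: eval_nat_numeral)
qed

theorem theorem4:
  fixes dummy :: "'a::comm_ring_1 \<times> 'n::finite"
  assumes "\<exists>x::'a. x \<noteq> 0 \<and> (\<exists>y::'a. y \<noteq> 0 \<and> x * y = 0)"
    and "CARD('n) > 1"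
  shows "orth_connected (matrix_matrix_mult :: 'a^'n^'n \<Rightarrow> 'a^'n^'n \<Rightarrow> 'a^'n^'n) 0
       \<and> orth_diam (matrix_matrix_mult :: 'a^'n^'n \<Rightarrow> 'a^'n^'n \<Rightarrow> 'a^'n^'n) 0 \<le> 4"
proof -
  obtain \<beta> \<gamma> :: 'a where "\<beta> \<noteq> 0" "\<gamma> \<noteq> 0" "\<beta> * \<gamma> = 0"
    using assms(1) by blast
  then have "orth_within (**) 0 4 X Y"
    if "X \<in> orth_vertices (**) 0" "Y \<in> orth_vertices (**) 0" for X Y :: "'a^'n^'n"
    using matrix_orth_within_4 that by blast
  then show ?thesis
    using orth_connected_diam_le[of "(**) :: 'a^'n^'n \<Rightarrow> _" 0 4] by (simp add: numeral_eq_enat)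
qed

end
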